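(* Let $G$ be a locally compact group acting continuously on a locally compact Hausdorff space $X$, and let $\alpha$ be the associated action of $G$ on $C_0(X)$. Then the $G$-space $X$ is proper if and only if for all $f,g\in C_0(X)$ the map $s\mapsto \alpha_s(f)g$ from $G$ to $C_0(X)$ vanishes at infinity.
   Context: The $G$-space $X$ is proper if the map $X\times G\to X\times X$, $(x,s)\mapsto (x,sx)$, is proper, i.e. inverse images of compact sets are compact. The associated action is $\alpha_s(f)(x)=f(s^{-1}x)$ for $s\in G$, $f\in C_0(X)$, $x\in X$. A map $h$ from $G$ to a Banach space vanishes at infinity if for every $\epsilon>0$ there is a compact $K\subset G$ with $\|h(s)\|<\epsilon$ for all $s\notin K$. *)

theory Defs
  imports "HOL-Analysis.Analysis" "HOL-Algebra.Group_Action"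
begin

definition topological_group :: "('g, 'm) monoid_scheme \<Rightarrow> 'g topology \<Rightarrow> bool"
  where "topological_group G T \<longleftrightarrow>
    group G \<and> topspace T = carrier G \<and>
    continuous_map (prod_topology T T) T (\<lambda>(s, t). s \<otimes>\<^bsub>G\<^esub> t) \<and>
    continuous_map T T (\<lambda>s. inv\<^bsub>G\<^esub> s)"

text \<open>The Hausdorff axiom is not imposed on the group.\<close>

definition locally_compact_group :: "('g, 'm) monoid_scheme \<Rightarrow> 'g topology \<Rightarrow> bool"
  where "locally_compact_group G T \<longleftrightarrow> topological_group G T \<and> locally_compact_space T"

definition continuous_action ::
    "('g, 'm) monoid_scheme \<Rightarrow> 'g topology \<Rightarrow> 'x topology \<Rightarrow> ('g \<Rightarrow> 'x \<Rightarrow> 'x) \<Rightarrow> bool"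
  where "continuous_action G T X \<phi> \<longleftrightarrow>
    group_action G (topspace X) \<phi> \<and>
    continuous_map (prod_topology T X) X (\<lambda>(s, x). \<phi> s x)"

text \<open>Properness in the sense that preimages of compact sets are compact; the constant
  \<^const>\<open>proper_map\<close> of the library instead means closed with compact fibres.\<close>

definition proper_G_space :: "'g topology \<Rightarrow> 'x topology \<Rightarrow> ('g \<Rightarrow> 'x \<Rightarrow> 'x) \<Rightarrow> bool"
  where "proper_G_space T X \<phi> \<longleftrightarrow>
    (\<forall>K. compactin (prod_topology X X) K \<longrightarrow>
      compactin (prod_topology X T)
        {p \<in> topspace (prod_topology X T). (\<lambda>(x, s). (x, \<phi> s x)) p \<in> K})"

text \<open>The target is given by its norm \<open>N\<close>, so that the definition applies both to scalar
  functions and to maps into the space \<open>C0 X\<close> below, which is a set and not a type.\<close>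

definition vanishes_at_infinity :: "'a topology \<Rightarrow> ('b \<Rightarrow> real) \<Rightarrow> ('a \<Rightarrow> 'b) \<Rightarrow> bool"
  where "vanishes_at_infinity T N h \<longleftrightarrow>
    (\<forall>\<epsilon>>0. \<exists>K. compactin T K \<and> (\<forall>s \<in> topspace T - K. N (h s) < \<epsilon>))"

text \<open>Functions on \<open>X\<close> are represented as total functions equal to \<^const>\<open>undefined\<close>
  outside \<^term>\<open>topspace X\<close>, as is done for group actions in HOL-Algebra.\<close>

definition C0 :: "'x topology \<Rightarrow> ('x \<Rightarrow> complex) set"
  where "C0 X = {f \<in> extensional (topspace X).
    continuous_map X euclidean f \<and> vanishes_at_infinity X cmod f}"

text \<open>Inserting 0 only matters for empty \<open>X\<close>, where the supremum would be unspecified.\<close>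

definition C0_norm :: "'x topology \<Rightarrow> ('x \<Rightarrow> complex) \<Rightarrow> real"
  where "C0_norm X f = Sup (insert 0 ((\<lambda>x. cmod (f x)) ` topspace X))"

definition C0_mult :: "'x topology \<Rightarrow> ('x \<Rightarrow> complex) \<Rightarrow> ('x \<Rightarrow> complex) \<Rightarrow> ('x \<Rightarrow> complex)"
  where "C0_mult X f g = (\<lambda>x \<in> topspace X. f x * g x)"

definition C0_action ::
    "('g, 'm) monoid_scheme \<Rightarrow> 'x topology \<Rightarrow> ('g \<Rightarrow> 'x \<Rightarrow> 'x) \<Rightarrow>
      'g \<Rightarrow> ('x \<Rightarrow> complex) \<Rightarrow> ('x \<Rightarrow> complex)"
  where "C0_action G X \<phi> s f = (\<lambda>x \<in> topspace X. f (\<phi> (inv\<^bsub>G\<^esub> s) x))"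

lemma C0_bdd_above:
  assumes "f \<in> C0 X"
  shows "bdd_above (insert 0 ((\<lambda>x. cmod (f x)) ` topspace X))"
proof -
  from assms have cont: "continuous_map X euclidean f" and "vanishes_at_infinity X cmod f"
    by (auto simp: C0_def)
  then obtain K where K: "compactin X K" "\<And>x. x \<in> topspace X - K \<Longrightarrow> cmod (f x) < 1"
    unfolding vanishes_at_infinity_def by (metis zero_less_one)
  have "compact (f ` K)"
    using image_compactin[OF K(1) cont] by simp
  then obtain B where B: "\<And>x. x \<in> K \<Longrightarrow> cmod (f x) \<le> B"
    by (meson bounded_iff compact_imp_bounded image_eqI)
  have "\<And>x. x \<in> topspace X \<Longrightarrow> cmod (f x) \<le> max 1 B"
    using B K(2) by (metis DiffI less_imp_le max.coboundedI1 max.coboundedI2)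
  then show ?thesis
    by (intro bdd_aboveI[of _ "max 1 B"]) auto
qed

lemma C0_mult_closed:
  assumes "f \<in> C0 X" "g \<in> C0 X"
  shows "C0_mult X f g \<in> C0 X"
proof -
  have cont: "continuous_map X euclidean f" "continuous_map X euclidean g"
    using assms by (auto simp: C0_def)
  have "bdd_above (insert 0 ((\<lambda>x. cmod (f x)) ` topspace X))"
    using assms(1) by (rule C0_bdd_above)
  then obtain B where B: "\<And>x. x \<in> topspace X \<Longrightarrow> cmod (f x) \<le> B" "B \<ge> 0"
    by (auto simp: bdd_above_def)
  have "continuous_map X euclidean (C0_mult X f g)"
  proof (rule continuous_map_eq)
    show "continuous_map X euclidean (\<lambda>x. f x * g x)"
      using cont by (simp add: continuous_map_atin tendsto_mult)
  qed (simp add: C0_mult_def)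
  moreover have "vanishes_at_infinity X cmod (C0_mult X f g)"
    unfolding vanishes_at_infinity_def
  proof (intro allI impI)
    fix e :: real assume "e > 0"
    then have "e / (B + 1) > 0" using B(2) by simp
    then obtain K where K: "compactin X K"
      "\<And>x. x \<in> topspace X - K \<Longrightarrow> cmod (g x) < e / (B + 1)"
      using assms(2) unfolding C0_def vanishes_at_infinity_def by blast
    have "cmod (C0_mult X f g x) < e" if x: "x \<in> topspace X - K" for x
    proof -
      have "cmod (f x) * cmod (g x) \<le> B * cmod (g x)"
        using B(1) x by (intro mult_right_mono) auto
      also have "\<dots> \<le> (B + 1) * cmod (g x)"
        by (simp add: algebra_simps)
      also have "\<dots> < e"
        using K(2)[OF x] B(2) by (simp add: field_simps)
      finally show ?thesis
        using x by (simp add: C0_mult_def norm_mult)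
    qed
    with K(1) show "\<exists>K. compactin X K \<and> (\<forall>s\<in>topspace X - K. cmod (C0_mult X f g s) < e)"
      by blast
  qed
  ultimately show ?thesis
    by (simp add: C0_def C0_mult_def)
qed

lemma C0_action_closed:
  assumes top: "topspace T = carrier G" and act: "continuous_action G T X \<phi>"
    and s: "s \<in> carrier G" and f: "f \<in> C0 X"
  shows "C0_action G X \<phi> s f \<in> C0 X"
proof -
  interpret group_action G "topspace X" \<phi>
    using act by (simp add: continuous_action_def)
  interpret group G
    using group_hom by (simp add: group_hom_def)
  have cont: "continuous_map X X (\<phi> t)" if "t \<in> carrier G" for t
  proof -
    have "continuous_map X (prod_topology T X) (\<lambda>x. (t, x))"
      using that top by (intro continuous_map_pairedI) auto
    then have "continuous_map X X ((\<lambda>(s, x). \<phi> s x) \<circ> (\<lambda>x. (t, x)))"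
      using act unfolding continuous_action_def by (blast intro: continuous_map_compose)
    then show ?thesis by (simp add: o_def)
  qed
  have is_carr: "inv\<^bsub>G\<^esub> s \<in> carrier G" using s by simp
  have cf: "continuous_map X euclidean f" using f by (simp add: C0_def)
  have "continuous_map X euclidean (f \<circ> \<phi> (inv\<^bsub>G\<^esub> s))"
    using cont[OF is_carr] cf by (rule continuous_map_compose)
  then have "continuous_map X euclidean (C0_action G X \<phi> s f)"
    by (rule continuous_map_eq) (simp add: C0_action_def)
  moreover have "vanishes_at_infinity X cmod (C0_action G X \<phi> s f)"
    unfolding vanishes_at_infinity_def
  proof (intro allI impI)
    fix e :: real assume "e > 0"
    then obtain K where K: "compactin X K" "\<And>x. x \<in> topspace X - K \<Longrightarrow> cmod (f x) < e"
      using f unfolding C0_def vanishes_at_infinity_def by blast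
    have "compactin X (\<phi> s ` K)"
      using image_compactin[OF K(1) cont[OF s]] .
    moreover have "cmod (C0_action G X \<phi> s f x) < e" if x: "x \<in> topspace X - \<phi> s ` K" for x
    proof -
      have y: "\<phi> (inv\<^bsub>G\<^esub> s) x \<in> topspace X"
        using x is_carr element_image by blast
      have "\<phi> s (\<phi> (inv\<^bsub>G\<^esub> s) x) = x"
        using x s is_carr orbit_sym_aux[OF is_carr, of x] by auto
      then have "\<phi> (inv\<^bsub>G\<^esub> s) x \<notin> K"
        using x by force
      then show ?thesis
        using K(2) x y by (simp add: C0_action_def)
    qed
    ultimately show "\<exists>K. compactin X K \<and>
        (\<forall>t\<in>topspace X - K. cmod (C0_action G X \<phi> s f t) < e)"
      by blast
  qed
  ultimately show ?thesis
    by (simp add: C0_def C0_action_def)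
qed

end

theory Submission
  imports Defs
begin

text \<open>Both sides of the equivalence say the same thing about return sets: for compact
  \<open>A, B \<subseteq> X\<close>, the set of all \<open>s\<close> for which \<open>sA\<close> meets \<open>B\<close> lies in a compact subset of \<open>G\<close>.

  For properness this is \<open>proper_G_space_iff_return_sets\<close>: the return set is the projection
  to \<open>G\<close> of the preimage of \<open>A \<times> B\<close>, and conversely the preimage of a compact \<open>K\<close> is a closed
  subset of \<open>A \<times> C\<close>, where \<open>A\<close> and \<open>B\<close> are the projections of \<open>K\<close> and \<open>C\<close> is a compact set
  containing the return set of \<open>A\<close> and \<open>B\<close>.

  For the functions, \<open>(\<alpha>\<^sub>s(f) g)(sx) = f(x) g(sx)\<close>. If \<open>f\<close> and \<open>g\<close> are small off \<open>A\<close> and \<open>B\<close>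
  respectively, then this product can be large only when \<open>x \<in> A\<close> and \<open>sx \<in> B\<close>, that is, when
  \<open>s\<close> is in the return set. If \<open>f = 1\<close> on \<open>A\<close> and \<open>g = 1\<close> on \<open>B\<close>, which Urysohn's lemma
  provides, then every \<open>s\<close> in the return set has \<open>\<parallel>\<alpha>\<^sub>s(f) g\<parallel> \<ge> 1\<close>, so that vanishing at
  infinity confines the return set to a compact set.\<close>

lemma cmod_le_C0_norm:
  assumes "f \<in> C0 X" and "x \<in> topspace X"
  shows "cmod (f x) \<le> C0_norm X f"
  unfolding C0_norm_def by (rule cSup_upper) (use assms C0_bdd_above in auto)

lemma C0_norm_leI:
  assumes "0 \<le> c" and "\<And>x. x \<in> topspace X \<Longrightarrow> cmod (f x) \<le> c"
  shows "C0_norm X f \<le> c"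
  unfolding C0_norm_def by (rule cSup_least) (use assms in auto)

lemma C0_smallE:
  assumes "f \<in> C0 X" and "0 < e"
  obtains K where "compactin X K" and "\<And>x. x \<in> topspace X - K \<Longrightarrow> cmod (f x) < e"
  using assms unfolding C0_def vanishes_at_infinity_def by blast

text \<open>Local compactness places \<open>A\<close> in an open set \<open>U\<close> inside a compact set \<open>L\<close>. A Urysohn
  function that is 1 on \<open>A\<close> and 0 off \<open>U\<close> is 0 off \<open>L\<close>, hence vanishes at infinity.\<close>

lemma C0_Urysohn:
  assumes lc: "locally_compact_space X" and haus: "Hausdorff_space X" and A: "compactin X A"
  obtains f where "f \<in> C0 X" and "\<And>x. x \<in> A \<Longrightarrow> f x = 1"
proof -
  obtain U L where UL: "openin X U" "compactin X L" "A \<subseteq> U" "U \<subseteq> L"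
    using lc haus A by (metis locally_compact_space_compact_closed_compact)
  have "completely_regular_space X"
    using lc haus
    by (simp add: locally_compact_Hausdorff_imp_regular_space
        locally_compact_regular_imp_completely_regular_space)
  moreover have "closedin X (topspace X - U)"
    using UL(1) by blast
  moreover have "disjnt A (topspace X - U)"
    using UL(3) by (auto simp: disjnt_def)
  ultimately obtain h :: "'a \<Rightarrow> real" where h: "continuous_map X euclideanreal h"
      "h ` (topspace X - U) \<subseteq> {0}" "h ` A \<subseteq> {1}"
    using A by (metis Urysohn_completely_regular_compact_closed_alt)
  define f where "f = (\<lambda>x \<in> topspace X. complex_of_real (h x))"
  have "continuous_map X euclidean (\<lambda>x. complex_of_real (h x))"
    using h(1) by (simp add: continuous_map_atin tendsto_of_real)
  then have "continuous_map X euclidean f"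
    by (rule continuous_map_eq) (simp add: f_def)
  moreover have "f x = 0" if "x \<in> topspace X - L" for x
    using that h(2) UL(4) by (auto simp: f_def)
  then have "vanishes_at_infinity X cmod f"
    unfolding vanishes_at_infinity_def using UL(2) by (metis norm_zero)
  ultimately have "f \<in> C0 X"
    by (simp add: C0_def f_def)
  moreover have "f x = 1" if "x \<in> A" for x
    using that h(3) compactin_subset_topspace[OF A] by (auto simp: f_def)
  ultimately show ?thesis
    using that by blast
qed

text \<open>The converse direction uses that \<open>X \<times> X\<close> is Hausdorff: this makes \<open>K\<close>, and with it its
  preimage, closed, so that the preimage inherits compactness from a product containing it.\<close>

lemma proper_G_space_iff_return_sets:
  assumes haus: "Hausdorff_space X"
    and cont: "continuous_map (prod_topology T X) X (\<lambda>(s, x). \<phi> s x)"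
  shows "proper_G_space T X \<phi> \<longleftrightarrow>
    (\<forall>A B. compactin X A \<longrightarrow> compactin X B \<longrightarrow>
      (\<exists>C. compactin T C \<and> {s \<in> topspace T. \<exists>x\<in>A. \<phi> s x \<in> B} \<subseteq> C))"
    (is "_ \<longleftrightarrow> ?return")
proof
  assume proper: "proper_G_space T X \<phi>"
  show ?return
  proof (intro allI impI)
    fix A B assume A: "compactin X A" and B: "compactin X B"
    let ?P = "{p \<in> topspace (prod_topology X T). (\<lambda>(x, s). (x, \<phi> s x)) p \<in> A \<times> B}"
    have "compactin (prod_topology X X) (A \<times> B)"
      using A B by (simp add: compactin_Times)
    then have "compactin (prod_topology X T) ?P"
      using proper unfolding proper_G_space_def by blast
    then have "compactin T (snd ` ?P)"
      by (rule image_compactin) (rule continuous_map_snd)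
    moreover have "{s \<in> topspace T. \<exists>x\<in>A. \<phi> s x \<in> B} \<subseteq> snd ` ?P"
      using compactin_subset_topspace[OF A] by (force simp: image_iff)
    ultimately show "\<exists>C. compactin T C \<and> {s \<in> topspace T. \<exists>x\<in>A. \<phi> s x \<in> B} \<subseteq> C"
      by blast
  qed
next
  assume return: ?return
  show "proper_G_space T X \<phi>"
    unfolding proper_G_space_def
  proof (intro allI impI)
    fix K assume K: "compactin (prod_topology X X) K"
    let ?P = "{p \<in> topspace (prod_topology X T). (\<lambda>(x, s). (x, \<phi> s x)) p \<in> K}"
    have A: "compactin X (fst ` K)"
      using K by (rule image_compactin) (rule continuous_map_fst)
    have B: "compactin X (snd ` K)"
      using K by (rule image_compactin) (rule continuous_map_snd)
    obtain C where C: "compactin T C" "{s \<in> topspace T. \<exists>x\<in>fst ` K. \<phi> s x \<in> snd ` K} \<subseteq> C"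
      using return A B by meson
    have "continuous_map (prod_topology X T) (prod_topology T X) (\<lambda>p. (snd p, fst p))"
      by (intro continuous_map_pairedI continuous_map_fst continuous_map_snd)
    then have "continuous_map (prod_topology X T) X ((\<lambda>(s, x). \<phi> s x) \<circ> (\<lambda>p. (snd p, fst p)))"
      using cont by (rule continuous_map_compose)
    then have "continuous_map (prod_topology X T) X (\<lambda>p. \<phi> (snd p) (fst p))"
      by (simp add: o_def case_prod_unfold)
    then have "continuous_map (prod_topology X T) (prod_topology X X) (\<lambda>(x, s). (x, \<phi> s x))"
      unfolding case_prod_unfold by (rule continuous_map_pairedI[OF continuous_map_fst])
    moreover have "closedin (prod_topology X X) K"
      using haus K by (simp add: compactin_imp_closedin Hausdorff_space_prod_topology)
    ultimately have "closedin (prod_topology X T) ?P"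
      by (rule closedin_continuous_map_preimage)
    moreover have "?P \<subseteq> fst ` K \<times> C"
    proof
      fix p assume p: "p \<in> ?P"
      obtain x s where [simp]: "p = (x, s)"
        by (cases p)
      have K': "(x, \<phi> s x) \<in> K" and "s \<in> topspace T"
        using p by simp_all
      moreover have "x \<in> fst ` K" "\<phi> s x \<in> snd ` K"
        using imageI[OF K', of fst] imageI[OF K', of snd] by simp_all
      ultimately show "p \<in> fst ` K \<times> C"
        using C(2) by auto
    qed
    moreover have "compactin (prod_topology X T) (fst ` K \<times> C)"
      using A C(1) by (simp add: compactin_Times)
    ultimately show "compactin (prod_topology X T) ?P"
      using closed_compactin by blast
  qed
qed

theorem proposition3p3:
  fixes G :: "('g, 'm) monoid_scheme" and T :: "'g topology"
    and X :: "'x topology" and \<phi> :: "'g \<Rightarrow> 'x \<Rightarrow> 'x"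
  assumes "locally_compact_group G T"
    and "locally_compact_space X" and "Hausdorff_space X"
    and "continuous_action G T X \<phi>"
  shows "proper_G_space T X \<phi> \<longleftrightarrow>
    (\<forall>f \<in> C0 X. \<forall>g \<in> C0 X.
      vanishes_at_infinity T (C0_norm X) (\<lambda>s. C0_mult X (C0_action G X \<phi> s f) g))"
proof -
  have top: "topspace T = carrier G"
    using assms(1) by (simp add: locally_compact_group_def topological_group_def)
  interpret group_action G "topspace X" \<phi>
    using assms(4) by (simp add: continuous_action_def)
  interpret group G
    using group_hom by (simp add: group_hom_def)
  have cont: "continuous_map (prod_topology T X) X (\<lambda>(s, x). \<phi> s x)"
    using assms(4) by (simp add: continuous_action_def)
  have moved_back: "\<phi> s (\<phi> (inv\<^bsub>G\<^esub> s) x) = x" "\<phi> (inv\<^bsub>G\<^esub> s) x \<in> topspace X"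
    if "s \<in> carrier G" "x \<in> topspace X" for s x
    using that orbit_sym_aux[of "inv\<^bsub>G\<^esub> s" x] element_image[of "inv\<^bsub>G\<^esub> s" x] by auto
  have moved: "\<phi> (inv\<^bsub>G\<^esub> s) (\<phi> s x) = x" "\<phi> s x \<in> topspace X"
    if "s \<in> carrier G" "x \<in> topspace X" for s x
    using that orbit_sym_aux[of s x] element_image[of s x] by auto
  show ?thesis
    unfolding proper_G_space_iff_return_sets[where T = T and X = X and \<phi> = \<phi>, OF assms(3) cont]
  proof (intro iffI ballI allI impI)
    fix f g assume f: "f \<in> C0 X" and g: "g \<in> C0 X"
    assume return: "\<forall>A B. compactin X A \<longrightarrow> compactin X B \<longrightarrow>
      (\<exists>C. compactin T C \<and> {s \<in> topspace T. \<exists>x\<in>A. \<phi> s x \<in> B} \<subseteq> C)"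
    show "vanishes_at_infinity T (C0_norm X) (\<lambda>s. C0_mult X (C0_action G X \<phi> s f) g)"
      unfolding vanishes_at_infinity_def
    proof (intro allI impI)
      fix e :: real assume e: "e > 0"
      define M where "M = max 1 (max (C0_norm X f) (C0_norm X g))"
      have M: "M > 0" "\<And>x. x \<in> topspace X \<Longrightarrow> cmod (f x) \<le> M"
          "\<And>x. x \<in> topspace X \<Longrightarrow> cmod (g x) \<le> M"
        using cmod_le_C0_norm[OF f] cmod_le_C0_norm[OF g] by (force simp: M_def)+
      \<comment> \<open>A product of two values, one at most \<open>M\<close> and the other below \<open>d\<close>, is at most \<open>e / 2\<close>;
        the factor 2 keeps the supremum strictly below \<open>e\<close>.\<close>
      define d where "d = e / (2 * M)"
      have d: "d > 0" "d * M = e / 2" "M * d = e / 2"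
        using e M(1) by (simp_all add: d_def)
      obtain A where A: "compactin X A" "\<And>x. x \<in> topspace X - A \<Longrightarrow> cmod (f x) < d"
        using C0_smallE[OF f d(1)] by blast
      obtain B where B: "compactin X B" "\<And>x. x \<in> topspace X - B \<Longrightarrow> cmod (g x) < d"
        using C0_smallE[OF g d(1)] by blast
      obtain C where C: "compactin T C" "{s \<in> topspace T. \<exists>x\<in>A. \<phi> s x \<in> B} \<subseteq> C"
        using return A(1) B(1) by meson
      have "C0_norm X (C0_mult X (C0_action G X \<phi> s f) g) < e" if s: "s \<in> topspace T - C" for s
      proof -
        have "C0_norm X (C0_mult X (C0_action G X \<phi> s f) g) \<le> e / 2"
        proof (rule C0_norm_leI)
          fix x assume x: "x \<in> topspace X"
          let ?y = "\<phi> (inv\<^bsub>G\<^esub> s) x"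
          have y: "\<phi> s ?y = x" "?y \<in> topspace X"
            using s x top moved_back by auto
          have "?y \<notin> A \<or> \<phi> s ?y \<notin> B"
            using s C(2) by blast
          then have "?y \<notin> A \<or> x \<notin> B"
            unfolding y(1) .
          then have "cmod (f ?y) * cmod (g x) \<le> e / 2"
          proof
            assume "?y \<notin> A"
            then have "cmod (f ?y) * cmod (g x) \<le> d * M"
              using A(2)[of ?y] M(3)[OF x] y d(1) by (intro mult_mono) auto
            then show ?thesis using d(2) by simp
          next
            assume "x \<notin> B"
            then have "cmod (f ?y) * cmod (g x) \<le> M * d"
              using B(2)[of x] M(1) M(2)[OF y(2)] x by (intro mult_mono) auto
            then show ?thesis using d(3) by simp
          qed
          then show "cmod (C0_mult X (C0_action G X \<phi> s f) g x) \<le> e / 2"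
            using x by (simp add: C0_mult_def C0_action_def norm_mult)
        qed (use e in simp)
        with e show ?thesis by simp
      qed
      with C(1) show "\<exists>C. compactin T C \<and>
          (\<forall>s\<in>topspace T - C. C0_norm X (C0_mult X (C0_action G X \<phi> s f) g) < e)"
        by blast
    qed
  next
    fix A B assume A: "compactin X A" and B: "compactin X B"
    assume vanish: "\<forall>f\<in>C0 X. \<forall>g\<in>C0 X.
      vanishes_at_infinity T (C0_norm X) (\<lambda>s. C0_mult X (C0_action G X \<phi> s f) g)"
    obtain f where f: "f \<in> C0 X" "\<And>x. x \<in> A \<Longrightarrow> f x = 1"
      using C0_Urysohn[OF assms(2,3) A] by blast
    obtain g where g: "g \<in> C0 X" "\<And>x. x \<in> B \<Longrightarrow> g x = 1"
      using C0_Urysohn[OF assms(2,3) B] by blast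
    have "vanishes_at_infinity T (C0_norm X) (\<lambda>s. C0_mult X (C0_action G X \<phi> s f) g)"
      using vanish f(1) g(1) by blast
    then obtain C where C: "compactin T C"
        "\<And>s. s \<in> topspace T - C \<Longrightarrow> C0_norm X (C0_mult X (C0_action G X \<phi> s f) g) < 1"
      unfolding vanishes_at_infinity_def by (metis zero_less_one)
    have "s \<in> C" if s: "s \<in> topspace T" and x: "x \<in> A" "\<phi> s x \<in> B" for s x
    proof (rule ccontr)
      assume "s \<notin> C"
      let ?h = "C0_mult X (C0_action G X \<phi> s f) g"
      have xX: "x \<in> topspace X"
        using x(1) compactin_subset_topspace[OF A] by blast
      have "?h (\<phi> s x) = 1"
        using moved[of s x] s xX top x f(2) g(2) by (simp add: C0_mult_def C0_action_def)
      moreover have "?h \<in> C0 X"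
        using C0_action_closed[OF top assms(4) _ f(1)] g(1) s top by (intro C0_mult_closed) auto
      ultimately have "1 \<le> C0_norm X ?h"
        using cmod_le_C0_norm[of ?h X "\<phi> s x"] moved(2)[of s x] s xX top by simp
      then show False
        using C(2)[of s] s \<open>s \<notin> C\<close> by simp
    qed
    with C(1) show "\<exists>C. compactin T C \<and> {s \<in> topspace T. \<exists>x\<in>A. \<phi> s x \<in> B} \<subseteq> C"
      by blast
  qed
qed

end
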